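(* Let $X$ and $Y$ be two polytopes in $\mathbb{R}^n$ with $-X \subset Y^\circ$, $\dim X = 1$, $\partial X = \{x_1, x_2\}$ with $x_2 \neq 0$, and $\dim Y = n$. Then $$\max_{d \in \mathbb{S}} r_{X,Y}(d) = \max\{ r_{X,Y}(x_2),\ r_{X,Y}(-x_2) \}.$$
   Context: A polytope in $\mathbb{R}^n$ is a compact intersection of finitely many half-spaces (so polytopes are convex). $\|\cdot\|$ is the Euclidean norm, $\mathbb{S} = \{x \in \mathbb{R}^n : \|x\| = 1\}$, $\mathbb{R}^+ d = \{\lambda d : \lambda \ge 0\}$, $-X = \{-x : x \in X\}$, and $Y^\circ$ is the interior of $Y$. Since $\dim X = 1$, $X$ is a line segment, and $\partial X = \{x_1, x_2\}$ denotes its two (distinct) endpoints. The Maximax Minimax Quotient is $$ r_{X,Y}(d) := \frac{\max_{x \in X,\, y \in Y} \{ \|x+y\| : x+y \in \mathbb{R}^+ d \}}{\min_{x \in X} \big\{ \max_{y \in Y} \{ \|x+y\| : x+y \in \mathbb{R}^+ d \} \big\}}. $$ The formula depends only on the ray $\mathbb{R}^+ d$, so $r_{X,Y}(\pm x_2)$ is the value in the unit direction $\pm x_2/\|x_2\|$.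
   Formalization: Here dim X is the dimension of the linear span, so X lies on a line through the origin; with affine dimension the claim fails, e.g. X = [-1,1]×{5}, Y = [-10,10]×[-15,5] has r = 11/9 at (1,0) but r = 1 at ±x_2. *)

theory Defs
  imports "HOL-Analysis.Analysis"
begin

text \<open>
  The library's \<^const>\<open>polytope\<close> (convex hull of a finite set) agrees with compact
  intersections of finitely many half-spaces.
\<close>

lemma polytope_iff_compact_polyhedron:
  fixes S :: "'a::euclidean_space set"
  shows "polytope S \<longleftrightarrow> compact S \<and> polyhedron S"
  using polytope_eq_bounded_polyhedron polytope_imp_compact compact_imp_bounded by blast

definition ray :: "'a::real_vector \<Rightarrow> 'a set" where
  "ray d = {c *\<^sub>R d | c. 0 \<le> c}"

text \<open>
  Attained maxima and minima of possibly infinite sets: unlike \<^const>\<open>Sup\<close> and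
  \<^const>\<open>Inf\<close>, these are unspecified unless the extremum is an element of the set.
\<close>

definition maximum :: "real set \<Rightarrow> real" where
  "maximum A = (GREATEST a. a \<in> A)"

definition minimum :: "real set \<Rightarrow> real" where
  "minimum A = (LEAST a. a \<in> A)"

definition maximax_minimax_quotient ::
    "'a::real_normed_vector set \<Rightarrow> 'a set \<Rightarrow> 'a \<Rightarrow> real" where
  "maximax_minimax_quotient X Y d =
     maximum {norm (x + y) | x y. x \<in> X \<and> y \<in> Y \<and> x + y \<in> ray d} /
     minimum {maximum {norm (x + y) | y. y \<in> Y \<and> x + y \<in> ray d} | x. x \<in> X}"

text \<open>
  The dimension of a set is taken to be the library's \<^const>\<open>dim\<close>, the dimension of the
  linear span. So \<^prop>\<open>dim X = 1\<close> puts a segment \<^term>\<open>X\<close> on a line through the origin,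
  and an endpoint \<^prop>\<open>x2 \<noteq> 0\<close> gives the direction of that line. With \<^const>\<open>aff_dim\<close>
  instead, \<^term>\<open>X\<close> = [-1,1] * {5} and \<^term>\<open>Y\<close> = [-10,10] * [-15,5] in the plane would
  have quotient 11/9 in the directions (1,0) and (-1,0), but 1 along both endpoints of
  \<^term>\<open>X\<close> and their negatives.
\<close>

end

theory Submission
  imports Defs
begin

text \<open>
  For fixed \<^term>\<open>d\<close>, the inner maximum of the quotient is a nonnegative concave function
  of \<^term>\<open>x\<close> on \<^term>\<open>uminus ` Y\<close>. On the line spanned by \<^term>\<open>x2\<close> it is therefore bounded
  below by the chord from its value at any point of \<^term>\<open>X\<close> to \<open>0\<close> at either end of
  \<^term>\<open>uminus ` Y\<close>. In the directions \<^term>\<open>x2\<close> and \<^term>\<open>- x2\<close> the inner maximum equals such a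
  chord, so the worst ratio of two values on \<^term>\<open>X\<close> occurs there.
\<close>

section \<open>Attained maxima and minima of real sets\<close>

lemma maximum_equality:
  assumes "a \<in> A" and "\<And>x. x \<in> A \<Longrightarrow> x \<le> a"
  shows "maximum A = a"
  unfolding maximum_def using assms by (rule Greatest_equality)

lemma minimum_equality:
  assumes "a \<in> A" and "\<And>x. x \<in> A \<Longrightarrow> a \<le> x"
  shows "minimum A = a"
  unfolding minimum_def using assms by (rule Least_equality)

lemma compact_maximum:
  assumes "compact A" and "A \<noteq> {}"
  shows "maximum A \<in> A" and "x \<in> A \<Longrightarrow> x \<le> maximum A"
proof -
  obtain a where a: "a \<in> A" "\<forall>x\<in>A. x \<le> a"
    using compact_attains_sup[OF assms] by blast
  then have "maximum A = a" by (intro maximum_equality) auto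
  with a show "maximum A \<in> A" "x \<in> A \<Longrightarrow> x \<le> maximum A" by auto
qed

section \<open>Rays: rescaling and closedness\<close>

lemma ray_scaleR: "c > 0 \<Longrightarrow> ray (c *\<^sub>R d) = ray d"
proof (intro equalityI subsetI)
  fix z assume "c > 0" "z \<in> ray d"
  then obtain k where "k \<ge> 0" "z = k *\<^sub>R d" by (auto simp: ray_def)
  with \<open>c > 0\<close> have "k / c \<ge> 0" "z = (k / c) *\<^sub>R (c *\<^sub>R d)" by auto
  then show "z \<in> ray (c *\<^sub>R d)" unfolding ray_def by blast
next
  fix z assume "c > 0" "z \<in> ray (c *\<^sub>R d)"
  then obtain k where "k \<ge> 0" "z = (k * c) *\<^sub>R d" by (auto simp: ray_def)
  with \<open>c > 0\<close> show "z \<in> ray d" unfolding ray_def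
    by (metis (mono_tags, lifting) mem_Collect_eq less_imp_le mult_nonneg_nonneg)
qed

lemma quotient_scaleR:
  "c > 0 \<Longrightarrow> maximax_minimax_quotient X Y (c *\<^sub>R d) = maximax_minimax_quotient X Y d"
  by (simp add: maximax_minimax_quotient_def ray_scaleR)

lemma zero_in_ray [simp]: "0 \<in> ray d"
  by (auto simp: ray_def intro: exI[of _ 0])

lemma closed_ray: "closed (ray (d :: 'a::real_inner))"
proof (cases "d = 0")
  case True
  then have "ray d = {0}" by (auto simp: ray_def intro: exI[of _ 0])
  then show ?thesis by simp
next
  case False
  \<comment> \<open>Nonzero case: a point is on the ray when orthogonal projection onto the line of
    \<open>d\<close> fixes it and its inner product with \<open>d\<close> is nonnegative. Both
    conditions are closed.\<close>
  have "ray d = {z. z = ((z \<bullet> d) / (d \<bullet> d)) *\<^sub>R d} \<inter> {z. 0 \<le> z \<bullet> d}" (is "_ = ?R")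
  proof (intro equalityI subsetI)
    fix z assume "z \<in> ray d"
    then obtain c where "c \<ge> 0" "z = c *\<^sub>R d" by (auto simp: ray_def)
    then show "z \<in> ?R" using False by simp
  next
    fix z assume "z \<in> ?R"
    then have "z = ((z \<bullet> d) / (d \<bullet> d)) *\<^sub>R d" "0 \<le> (z \<bullet> d) / (d \<bullet> d)"
      by auto
    then show "z \<in> ray d" unfolding ray_def by blast
  qed
  moreover have "closed ?R"
    by (intro closed_Int closed_Collect_eq closed_Collect_le continuous_intros) (use False in auto)
  ultimately show ?thesis by simp
qed

section \<open>The inner maximum on a fixed ray\<close>

definition reach :: "'a::real_normed_vector set \<Rightarrow> 'a \<Rightarrow> 'a \<Rightarrow> real" where
  "reach Y d x = maximum {norm (x + y) | y. y \<in> Y \<and> x + y \<in> ray d}"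

text \<open>The hypothesis on \<open>- x\<close> puts \<open>0\<close> into the set of norms, and
  the closed ray cuts a compact piece out of the translate of \<open>Y\<close>. So the maximum is
  attained and \<open>maximum\<close> is not an unspecified value.\<close>

lemma reach_props:
  fixes Y :: "'a::real_inner set"
  assumes "compact Y" and "- x \<in> Y"
  shows reach_attained: "\<exists>y\<in>Y. x + y \<in> ray d \<and> reach Y d x = norm (x + y)"
    and reach_upper: "\<lbrakk>y \<in> Y; x + y \<in> ray d\<rbrakk> \<Longrightarrow> norm (x + y) \<le> reach Y d x"
proof -
  define A where "A = {norm (x + y) | y. y \<in> Y \<and> x + y \<in> ray d}"
  have "A = norm ` ((+) x ` Y \<inter> ray d)" by (auto simp: A_def)
  then have "compact A"
    using assms closed_ray
    by (auto intro!: compact_continuous_image compact_Int_closed compact_translation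
        continuous_intros)
  moreover have "norm (x + - x) \<in> A"
    unfolding A_def using assms by fastforce
  ultimately have "maximum A \<in> A" "\<And>a. a \<in> A \<Longrightarrow> a \<le> maximum A"
    using compact_maximum by auto
  moreover have "reach Y d x = maximum A" by (simp add: reach_def A_def)
  ultimately show "\<exists>y\<in>Y. x + y \<in> ray d \<and> reach Y d x = norm (x + y)"
    and "\<lbrakk>y \<in> Y; x + y \<in> ray d\<rbrakk> \<Longrightarrow> norm (x + y) \<le> reach Y d x"
    unfolding A_def by auto
qed

lemma reach_nonneg:
  fixes Y :: "'a::real_inner set"
  assumes "compact Y" and "- x \<in> Y"
  shows "0 \<le> reach Y d x"
  using reach_attained[OF assms, of d] by auto

text \<open>An interior point \<open>- x\<close> can be moved a little along \<open>d\<close> inside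
  \<open>Y\<close>, giving a nonzero sum on the ray. This keeps the denominator of the quotient
  positive.\<close>

lemma reach_pos:
  fixes Y :: "'a::real_inner set"
  assumes "compact Y" and "- x \<in> interior Y" and "d \<noteq> 0"
  shows "0 < reach Y d x"
proof -
  obtain e where e: "e > 0" "ball (- x) e \<subseteq> Y"
    using assms(2) by (auto simp: mem_interior)
  define y where "y = - x + (e / (2 * norm d)) *\<^sub>R d"
  have "y \<in> Y"
    using e assms(3) by (intro subsetD[OF e(2)]) (simp add: y_def dist_norm)
  moreover have "x + y \<in> ray d"
    using e assms(3) by (auto simp: y_def ray_def intro!: exI[of _ "e / (2 * norm d)"])
  ultimately have "norm (x + y) \<le> reach Y d x"
    using assms(2) interior_subset by (intro reach_upper[OF assms(1)]) blast+
  moreover have "0 < norm (x + y)"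
    using e assms(3) by (simp add: y_def)
  ultimately show ?thesis by linarith
qed

text \<open>All sums lie on one ray, where the norm is additive. A convex combination of maximisers
  for \<open>x\<close> and \<open>x'\<close> is therefore feasible and has exactly the combined
  norm.\<close>

lemma reach_concave:
  fixes Y :: "'a::real_inner set"
  assumes "compact Y" and "convex Y" and "- x \<in> Y" and "- x' \<in> Y"
    and "0 \<le> t" and "t \<le> 1"
  shows "(1 - t) * reach Y d x + t * reach Y d x' \<le> reach Y d ((1 - t) *\<^sub>R x + t *\<^sub>R x')"
proof -
  obtain y where y: "y \<in> Y" "x + y \<in> ray d" "reach Y d x = norm (x + y)"
    using reach_attained[OF assms(1,3)] by blast
  obtain y' where y': "y' \<in> Y" "x' + y' \<in> ray d" "reach Y d x' = norm (x' + y')"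
    using reach_attained[OF assms(1,4)] by blast
  obtain c c' where c: "c \<ge> 0" "x + y = c *\<^sub>R d" "c' \<ge> 0" "x' + y' = c' *\<^sub>R d"
    using y(2) y'(2) by (auto simp: ray_def)
  let ?x = "(1 - t) *\<^sub>R x + t *\<^sub>R x'" and ?y = "(1 - t) *\<^sub>R y + t *\<^sub>R y'"
  have "?x + ?y = (1 - t) *\<^sub>R (x + y) + t *\<^sub>R (x' + y')"
    by (simp add: algebra_simps)
  then have sum: "?x + ?y = ((1 - t) * c + t * c') *\<^sub>R d"
    by (simp add: c scaleR_add_left)
  have nonneg: "0 \<le> (1 - t) * c + t * c'" using c assms by simp
  have "?y \<in> Y" using assms y(1) y'(1) by (intro convexD) auto
  moreover have "- ?x \<in> Y"
    using convexD[OF assms(2-4), of "1 - t" t] assms by (simp add: algebra_simps)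
  moreover have "?x + ?y \<in> ray d" unfolding sum ray_def using nonneg by blast
  ultimately have "norm (?x + ?y) \<le> reach Y d ?x" using assms(1) reach_upper by blast
  moreover have "norm (?x + ?y) = (1 - t) * reach Y d x + t * reach Y d x'"
    unfolding sum norm_scaleR y(3) y'(3) c(2,4) abs_of_nonneg[OF nonneg]
    using c by (simp add: algebra_simps)
  ultimately show ?thesis by simp
qed

text \<open>Concavity between the parameters \<open>- q\<close> and \<open>r\<close>, with the value
  at \<open>- q\<close> bounded below by \<open>0\<close>. The factors are the distances of
  \<open>s\<close> and \<open>r\<close> from \<open>- q\<close>, and cross-multiplying avoids
  division.\<close>

lemma reach_chord:
  fixes Y :: "'a::real_inner set"
  assumes "compact Y" and "convex Y" and "q *\<^sub>R v \<in> Y" and "- (r *\<^sub>R v) \<in> Y"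
    and "- q < s" and "s \<le> r"
  shows "(q + s) * reach Y d (r *\<^sub>R v) \<le> (q + r) * reach Y d (s *\<^sub>R v)"
proof -
  define t where "t = (q + s) / (q + r)"
  have t: "0 \<le> t" "t \<le> 1" and pos: "0 < q + r"
    using assms by (auto simp: t_def)
  have s: "s = (1 - t) * (- q) + t * r"
  proof -
    have "t * (q + r) = q + s" using pos by (simp add: t_def)
    then show ?thesis by (simp add: algebra_simps)
  qed
  have "t * reach Y d (r *\<^sub>R v)
      \<le> (1 - t) * reach Y d ((- q) *\<^sub>R v) + t * reach Y d (r *\<^sub>R v)"
    using reach_nonneg[OF assms(1), of "(- q) *\<^sub>R v" d] assms(3) t by simp
  also have "\<dots> \<le> reach Y d ((1 - t) *\<^sub>R ((- q) *\<^sub>R v) + t *\<^sub>R (r *\<^sub>R v))"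
    using assms t by (intro reach_concave) auto
  also have "(1 - t) *\<^sub>R ((- q) *\<^sub>R v) + t *\<^sub>R (r *\<^sub>R v) = s *\<^sub>R v"
    by (subst s) (simp only: scaleR_add_left scaleR_scaleR)
  finally show ?thesis using pos by (simp add: t_def field_simps)
qed

section \<open>The quotient for a segment on a line through the origin\<close>

locale segment_on_line =
  fixes Y :: "'a::euclidean_space set" and v :: 'a and a b :: real
  assumes compact_Y: "compact Y" and convex_Y: "convex Y" and v: "v \<noteq> 0" and ab: "a \<le> b"
    and int: "\<And>s. \<lbrakk>a \<le> s; s \<le> b\<rbrakk> \<Longrightarrow> - (s *\<^sub>R v) \<in> interior Y"
begin

abbreviation "X \<equiv> (\<lambda>s. s *\<^sub>R v) ` {a..b}"

lemma neg_in_Y: "\<lbrakk>a \<le> s; s \<le> b\<rbrakk> \<Longrightarrow> - (s *\<^sub>R v) \<in> Y"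
  using int interior_subset by blast

text \<open>The sums on the ray form a compact set, and the \<open>X\<close>-component of a longest
  one gives \<open>r\<close>. Each \<open>reach\<close> value is itself the norm of such a sum, so
  none exceeds the joint maximum.\<close>

lemma maximax_attained:
  obtains r where "a \<le> r" "r \<le> b"
    "maximum {norm (x + y) | x y. x \<in> X \<and> y \<in> Y \<and> x + y \<in> ray d} = reach Y d (r *\<^sub>R v)"
    "\<And>s. \<lbrakk>a \<le> s; s \<le> b\<rbrakk> \<Longrightarrow> reach Y d (s *\<^sub>R v) \<le> reach Y d (r *\<^sub>R v)"
proof -
  define A where "A = {norm (x + y) | x y. x \<in> X \<and> y \<in> Y \<and> x + y \<in> ray d}"
  have "A = norm ` ({x + y | x y. x \<in> X \<and> y \<in> Y} \<inter> ray d)" by (auto simp: A_def)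
  moreover have "compact X" by (intro compact_continuous_image continuous_intros) auto
  ultimately have "compact A"
    using compact_Y closed_ray
    by (auto intro!: compact_continuous_image compact_Int_closed compact_sums continuous_intros)
  moreover have in_A: "reach Y d (s *\<^sub>R v) \<in> A" if s: "a \<le> s" "s \<le> b" for s
  proof -
    obtain y where "y \<in> Y" "s *\<^sub>R v + y \<in> ray d" "reach Y d (s *\<^sub>R v) = norm (s *\<^sub>R v + y)"
      using reach_attained[OF compact_Y neg_in_Y[OF s]] by blast
    moreover have "s *\<^sub>R v \<in> X" using s by (intro imageI) simp
    ultimately show ?thesis unfolding A_def by blast
  qed
  ultimately have max: "maximum A \<in> A" "\<And>z. z \<in> A \<Longrightarrow> z \<le> maximum A"
    using compact_maximum[of A] ab by blast+
  then obtain r y where r: "a \<le> r" "r \<le> b" "y \<in> Y" "r *\<^sub>R v + y \<in> ray d"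
    "maximum A = norm (r *\<^sub>R v + y)"
    unfolding A_def by auto
  then have "maximum A \<le> reach Y d (r *\<^sub>R v)"
    using reach_upper[OF compact_Y neg_in_Y] by simp
  with max(2) in_A r(1,2) have "maximum A = reach Y d (r *\<^sub>R v)" by (simp add: antisym)
  with that[OF r(1,2)] max(2) in_A show thesis unfolding A_def by auto
qed

text \<open>A concave function on an interval is smallest at an endpoint, so attainment comes from
  concavity instead of continuity.\<close>

lemma minimax_attained:
  obtains m where "a \<le> m" "m \<le> b"
    "minimum {maximum {norm (x + y) | y. y \<in> Y \<and> x + y \<in> ray d} | x. x \<in> X}
      = reach Y d (m *\<^sub>R v)"
    "\<And>s. \<lbrakk>a \<le> s; s \<le> b\<rbrakk> \<Longrightarrow> reach Y d (m *\<^sub>R v) \<le> reach Y d (s *\<^sub>R v)"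
proof -
  define m where "m = (if reach Y d (a *\<^sub>R v) \<le> reach Y d (b *\<^sub>R v) then a else b)"
  have least: "reach Y d (m *\<^sub>R v) \<le> reach Y d (s *\<^sub>R v)" if s: "a \<le> s" "s \<le> b" for s
  proof (cases "a = b")
    case True
    with s show ?thesis by (simp add: m_def)
  next
    case False
    define t where "t = (s - a) / (b - a)"
    have t: "0 \<le> t" "t \<le> 1" using s by (auto simp: t_def divide_le_eq_1)
    have "s = a + t * (b - a)" using False by (simp add: t_def)
    then have eq: "s = (1 - t) * a + t * b" by (simp add: algebra_simps)
    have "reach Y d (m *\<^sub>R v)
        = (1 - t) * reach Y d (m *\<^sub>R v) + t * reach Y d (m *\<^sub>R v)"
      by (simp add: algebra_simps)
    also have "\<dots> \<le> (1 - t) * reach Y d (a *\<^sub>R v) + t * reach Y d (b *\<^sub>R v)"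
      using t by (intro add_mono mult_left_mono) (auto simp: m_def)
    also have "\<dots> \<le> reach Y d ((1 - t) *\<^sub>R (a *\<^sub>R v) + t *\<^sub>R (b *\<^sub>R v))"
      using t ab by (intro reach_concave compact_Y convex_Y neg_in_Y) auto
    also have "(1 - t) *\<^sub>R (a *\<^sub>R v) + t *\<^sub>R (b *\<^sub>R v) = s *\<^sub>R v"
      by (subst eq) (simp only: scaleR_add_left scaleR_scaleR)
    finally show ?thesis .
  qed
  have m: "a \<le> m" "m \<le> b" using ab by (auto simp: m_def)
  have "minimum {reach Y d x | x. x \<in> X} = reach Y d (m *\<^sub>R v)"
  proof (intro minimum_equality)
    have "m *\<^sub>R v \<in> X" using m by (intro imageI) simp
    then show "reach Y d (m *\<^sub>R v) \<in> {reach Y d x | x. x \<in> X}" by blast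
  qed (auto intro: least)
  then show thesis using that[OF m _ least] by (simp add: reach_def)
qed

lemma quotient_attained:
  obtains r m where "a \<le> r" "r \<le> b" "a \<le> m" "m \<le> b"
    "maximax_minimax_quotient X Y d = reach Y d (r *\<^sub>R v) / reach Y d (m *\<^sub>R v)"
    "\<And>s. \<lbrakk>a \<le> s; s \<le> b\<rbrakk> \<Longrightarrow>
      reach Y d (m *\<^sub>R v) \<le> reach Y d (s *\<^sub>R v) \<and> reach Y d (s *\<^sub>R v) \<le> reach Y d (r *\<^sub>R v)"
  by (rule maximax_attained[of d], rule minimax_attained[of d])
     (auto simp: maximax_minimax_quotient_def)

text \<open>The witness \<open>q\<close> is the coordinate of the farthest point of \<open>Y\<close>
  on the line in direction \<open>v\<close>. Comparing \<open>reach\<close> at the two ends of the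
  segment gives the bound.\<close>

lemma quotient_along_line:
  obtains q where "q *\<^sub>R v \<in> Y" "- a < q"
    "(q + b) / (q + a) \<le> maximax_minimax_quotient X Y v"
proof -
  define T where "T = {t. t *\<^sub>R v \<in> Y}"
  have "closed T" unfolding T_def
    using continuous_closed_vimage[OF compact_imp_closed[OF compact_Y], of "\<lambda>t. t *\<^sub>R v"]
    by (simp add: vimage_def)
  moreover have "bounded T"
  proof -
    obtain B where B: "\<And>y. y \<in> Y \<Longrightarrow> norm y \<le> B"
      using compact_imp_bounded[OF compact_Y] by (auto simp: bounded_iff)
    have "norm t \<le> B / norm v" if "t \<in> T" for t
      using B[of "t *\<^sub>R v"] that v by (simp add: T_def field_simps)
    then show ?thesis by (auto simp: bounded_iff)
  qed
  ultimately have "compact T" by (simp add: compact_eq_bounded_closed)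
  moreover have a_T: "- a \<in> T" using neg_in_Y[of a] ab by (simp add: T_def)
  ultimately obtain q where q: "q \<in> T" "\<And>t. t \<in> T \<Longrightarrow> t \<le> q"
    using compact_attains_sup[of T] by blast
  have qY: "q *\<^sub>R v \<in> Y" using q by (simp add: T_def)
  \<comment> \<open>A sum on the ray of \<open>v\<close> forces \<open>y\<close> onto the line as
    well, so its coordinate is at most \<open>q\<close>.\<close>
  have reach_le: "reach Y v (a *\<^sub>R v) \<le> (q + a) * norm v"
  proof -
    obtain y where y: "y \<in> Y" "a *\<^sub>R v + y \<in> ray v" "reach Y v (a *\<^sub>R v) = norm (a *\<^sub>R v + y)"
      using reach_attained[OF compact_Y neg_in_Y] ab by blast
    then obtain c where c: "c \<ge> 0" "a *\<^sub>R v + y = c *\<^sub>R v" by (auto simp: ray_def)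
    then have "y = (c - a) *\<^sub>R v" by (simp add: algebra_simps)
    with y(1) q(2) have "c - a \<le> q" by (simp add: T_def)
    then show ?thesis using c y(3) by (simp add: mult_right_mono)
  qed
  have pos: "0 < reach Y v (s *\<^sub>R v)" if "a \<le> s" "s \<le> b" for s
    using reach_pos[OF compact_Y int[OF that] v] .
  \<comment> \<open>Strictness comes from \<open>reach\<close> being positive at \<open>a\<close>
    and at most \<open>(q + a) * norm v\<close>.\<close>
  have qa: "- a < q"
    using order.strict_trans2[OF pos[of a] reach_le] ab v by (simp add: zero_less_mult_iff)
  have sum: "b *\<^sub>R v + q *\<^sub>R v = (q + b) *\<^sub>R v" by (simp add: algebra_simps)
  have "norm (b *\<^sub>R v + q *\<^sub>R v) \<le> reach Y v (b *\<^sub>R v)"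
  proof (rule reach_upper[OF compact_Y neg_in_Y])
    have "0 \<le> q + b" using qa ab by simp
    then show "b *\<^sub>R v + q *\<^sub>R v \<in> ray v" unfolding sum ray_def by blast
  qed (use ab qY in auto)
  then have reach_ge: "(q + b) * norm v \<le> reach Y v (b *\<^sub>R v)"
    unfolding sum using qa ab by simp
  obtain r m where rm: "a \<le> m" "m \<le> b"
    "maximax_minimax_quotient X Y v = reach Y v (r *\<^sub>R v) / reach Y v (m *\<^sub>R v)"
    "reach Y v (m *\<^sub>R v) \<le> reach Y v (a *\<^sub>R v)" "reach Y v (b *\<^sub>R v) \<le> reach Y v (r *\<^sub>R v)"
    using quotient_attained[of v] ab by (metis order_refl)
  have "(q + b) / (q + a) = ((q + b) * norm v) / ((q + a) * norm v)"
    using v by simp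
  also have "\<dots> \<le> reach Y v (r *\<^sub>R v) / reach Y v (m *\<^sub>R v)"
    using pos[of m] rm reach_le reach_ge pos[of b] ab
    by (intro frac_le) auto
  finally show thesis using that[OF qY qa] rm by simp
qed

text \<open>Traversing the line backwards makes \<open>quotient_along_line\<close> available for
  \<open>- v\<close> too, on the same segment by \<open>reversed_image\<close>.\<close>

lemma reversed: "segment_on_line Y (- v) (- b) (- a)"
proof
  show "- (s *\<^sub>R (- v)) \<in> interior Y" if "- b \<le> s" "s \<le> - a" for s
    using int[of "- s"] that by simp
qed (use compact_Y convex_Y v ab in auto)

lemma reversed_image: "(\<lambda>s. s *\<^sub>R (- v)) ` {- b..- a} = X"
proof -
  have "(\<lambda>s. s *\<^sub>R (- v)) ` {- b..- a} = (\<lambda>s. s *\<^sub>R v) ` uminus ` {- b..- a}"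
    unfolding image_image by simp
  also have "uminus ` {- b..- a} = {a..b}" by simp
  finally show ?thesis .
qed

text \<open>The order of the minimiser \<open>m\<close> and the maximiser \<open>r\<close> decides
  at which end of \<open>- Y\<close> on the line the chord descends to \<open>0\<close>. The ratio
  is then at most a quotient of distances to that end.\<close>

lemma quotient_le:
  assumes d: "d \<noteq> 0"
  shows "maximax_minimax_quotient X Y d
    \<le> max (maximax_minimax_quotient X Y v) (maximax_minimax_quotient X Y (- v))"
proof -
  interpret rev: segment_on_line Y "- v" "- b" "- a" by (rule reversed)
  obtain q where q: "q *\<^sub>R v \<in> Y" "- a < q"
    "(q + b) / (q + a) \<le> maximax_minimax_quotient X Y v"
    by (rule quotient_along_line)
  obtain p where p: "p *\<^sub>R (- v) \<in> Y" "b < p"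
    "(p - a) / (p - b) \<le> maximax_minimax_quotient X Y (- v)"
    using rev.quotient_along_line unfolding reversed_image by auto
  obtain r m where rm: "a \<le> r" "r \<le> b" "a \<le> m" "m \<le> b"
    "maximax_minimax_quotient X Y d = reach Y d (r *\<^sub>R v) / reach Y d (m *\<^sub>R v)"
    by (rule quotient_attained)
  have pos: "0 < reach Y d (m *\<^sub>R v)"
    using reach_pos[OF compact_Y int d] rm by simp
  show ?thesis
  proof (cases "m \<le> r")
    case True
    have "(q + m) * reach Y d (r *\<^sub>R v) \<le> (q + r) * reach Y d (m *\<^sub>R v)"
      using q rm True by (intro reach_chord compact_Y convex_Y neg_in_Y) auto
    then have "maximax_minimax_quotient X Y d \<le> (q + r) / (q + m)"
      using pos q rm(1-4) unfolding rm(5) by (simp add: divide_le_eq le_divide_eq mult.commute)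
    \<comment> \<open>The quotient increases with \<open>r\<close> and decreases with
      \<open>m\<close>, so the extreme case is \<open>r = b\<close>, \<open>m = a\<close>.\<close>
    also have "\<dots> \<le> (q + b) / (q + a)" using q rm by (intro frac_le) auto
    finally show ?thesis using q by simp
  next
    case False
    \<comment> \<open>Coordinates are now taken along \<open>- v\<close>: the points become
      \<open>- r\<close> and \<open>- m\<close>, their order flips, and the chord starts at
      \<open>- p\<close>.\<close>
    have "(p + - m) * reach Y d ((- r) *\<^sub>R (- v)) \<le> (p + - r) * reach Y d ((- m) *\<^sub>R (- v))"
      using p rm False by (intro reach_chord compact_Y convex_Y rev.neg_in_Y) auto
    then have "maximax_minimax_quotient X Y d \<le> (p - r) / (p - m)"
      using pos p rm(1-4) unfolding rm(5) by (simp add: divide_le_eq le_divide_eq mult.commute)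
    also have "\<dots> \<le> (p - a) / (p - b)" using p rm by (intro frac_le) auto
    finally show ?thesis using p by simp
  qed
qed

end

section \<open>Reduction of the theorem to a segment on a line\<close>

text \<open>Because \<open>dim\<close> refers to the linear span, all of \<open>X\<close> lies on
  the line of \<open>v\<close>. Its coordinates form a compact connected set of reals, hence an
  interval.\<close>

lemma compact_convex_on_line:
  fixes X :: "'a::euclidean_space set"
  assumes "compact X" and "convex X" and "dim X = 1" and "v \<in> X" and "v \<noteq> 0"
  obtains a b where "a \<le> b" "X = (\<lambda>s. s *\<^sub>R v) ` {a..b}"
proof -
  have "span X \<subseteq> span {v}"
    using assms by (intro dim_eq_span[THEN equalityD2]) auto
  then have on_line: "\<exists>s. x = s *\<^sub>R v" if "x \<in> X" for x
    using that span_superset[of X] by (auto simp: span_singleton)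
  \<comment> \<open>The coordinate along \<open>v\<close>, written with inner products so that
    continuity is immediate.\<close>
  define f where "f x = (x \<bullet> v) / (v \<bullet> v)" for x
  have f: "x = f x *\<^sub>R v" if "x \<in> X" for x
    using on_line[OF that] assms(5) by (auto simp: f_def)
  have "continuous_on X f" unfolding f_def by (intro continuous_intros) (use assms in auto)
  then have "compact (f ` X)" "connected (f ` X)"
    using assms compact_continuous_image connected_continuous_image convex_connected by blast+
  then obtain a b where ab: "f ` X = {a..b}" using connected_compact_interval_1 by metis
  have "(\<lambda>s. s *\<^sub>R v) ` f ` X = X" unfolding image_image using f by force
  moreover have "f v \<in> {a..b}" unfolding ab[symmetric] using assms(4) by (rule imageI)
  then have "a \<le> b" by simp
  ultimately show thesis using that ab by simp
qed

theorem theorem2: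
  fixes X Y :: "(real ^ 'n) set" and x1 x2 :: "real ^ 'n"
  assumes "polytope X" and "polytope Y"
    and "uminus ` X \<subseteq> interior Y"
    and "dim X = 1"
    and "rel_frontier X = {x1, x2}" and "x1 \<noteq> x2" and "x2 \<noteq> 0"
    and "dim Y = CARD('n)"
  shows "(\<exists>d\<in>sphere 0 1. \<forall>d'\<in>sphere 0 1.
            maximax_minimax_quotient X Y d' \<le> maximax_minimax_quotient X Y d) \<and>
         maximum {maximax_minimax_quotient X Y d | d. d \<in> sphere 0 1} =
           max (maximax_minimax_quotient X Y x2) (maximax_minimax_quotient X Y (- x2))"
proof -
  let ?r = "maximax_minimax_quotient X Y"
  have "x2 \<in> X"
    using assms(5) polytope_imp_closed[OF assms(1)] by (auto simp: rel_frontier_def)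
  then obtain a b where ab: "a \<le> b" "X = (\<lambda>s. s *\<^sub>R x2) ` {a..b}"
    using assms polytope_imp_compact polytope_imp_convex compact_convex_on_line by metis
  then interpret seg: segment_on_line Y x2 a b
    using assms by unfold_locales (auto simp: polytope_imp_compact polytope_imp_convex)
  have le: "?r d \<le> max (?r x2) (?r (- x2))" if "d \<in> sphere 0 1" for d
    using seg.quotient_le[of d] that ab by fastforce
  \<comment> \<open>The quotient depends only on the ray, so normalising \<open>x2\<close> and
    \<open>- x2\<close> turns the upper bound into a value on the sphere.\<close>
  let ?u = "(1 / norm x2) *\<^sub>R x2"
  have sph: "?u \<in> sphere 0 1" "- ?u \<in> sphere 0 1" using assms(7) by auto
  have "?r ?u = ?r x2" "?r (- ?u) = ?r (- x2)"
    using assms(7) quotient_scaleR[of "1 / norm x2" X Y x2]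
      quotient_scaleR[of "1 / norm x2" X Y "- x2"] by simp_all
  then obtain d where d: "d \<in> sphere 0 1" "?r d = max (?r x2) (?r (- x2))"
    using sph unfolding max_def by metis
  have "maximum {?r d | d. d \<in> sphere 0 1} = ?r d"
  proof (rule maximum_equality)
    show "?r d \<in> {?r d | d. d \<in> sphere 0 1}" using d(1) by blast
  qed (use d le in auto)
  then show ?thesis using d le by metis
qed

end
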